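(* Let $\mathbf c\in\mathbb Z_{\ge0}^n$ and let $M$ be a proper $\mathbf c$-multicomplex. Then $\mathrm{Bier}_{\mathbf c}(M)$ is edge decomposable.
   Context: Fix $\mathbf c=(c_1,\dots,c_n)\in\mathbb Z_{\ge0}^n$ and write $x^{\mathbf a}=x_1^{a_1}\cdots x_n^{a_n}$. A $\mathbf c$-monomial is $x^{\mathbf a}$ with $a_i\le c_i$ for all $i$. A $\mathbf c$-multicomplex is a nonempty set $M$ of $\mathbf c$-monomials closed under taking divisors; it is proper if it is not the set of all $\mathbf c$-monomials. Let $\widetilde X=\{x_i^{(j)}:1\le i\le n,\ 0\le j\le c_i\}$ (new symbols). For a $\mathbf c$-monomial $x^{\mathbf a}$ put $F_{\mathbf c}(x^{\mathbf a})=\widetilde X\setminus\{x_1^{(a_1)},\dots,x_n^{(a_n)}\}$; $\mathcal B_{\mathbf c}(M)$ is the simplicial complex consisting of all subsets of the sets $F_{\mathbf c}(x^{\mathbf a})$, $x^{\mathbf a}\in M$. For a pure $(d-1)$-dimensional complex $B$, $\partial B$ is the complex generated by the $(d-1)$-element faces lying in exactly one facet. For proper $M$, $\mathrm{Bier}_{\mathbf c}(M)=\partial\mathcal B_{\mathbf c}(M)$. For a simplicial complex $\Delta$ on $V$: $\mathrm{lk}_\Delta(F)=\{G\subset V\setminus F:G\cup F\in\Delta\}$; for an edge $\{i,j\}\in\Delta$ the contraction is $\mathcal C_\Delta(i,j)=\{F\in\Delta:i\notin F\}\cup\{(F\setminus\{i\})\cup\{j\}:i\in F\in\Delta\}$ (a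 complex on $V\setminus\{i\}$); $\Delta$ satisfies the Link condition w.r.t. $\{i,j\}$ if $\mathrm{lk}_\Delta(\{i\})\cap\mathrm{lk}_\Delta(\{j\})=\mathrm{lk}_\Delta(\{i,j\})$. Edge decomposability is defined recursively: the boundary complex of a simplex and $\{\emptyset\}$ are edge decomposable, and a pure simplicial complex $\Delta$ is edge decomposable if there is an edge $\{i,j\}\in\Delta$ such that $\Delta$ satisfies the Link condition w.r.t. $\{i,j\}$ and both $\mathrm{lk}_\Delta(\{i,j\})$ and $\mathcal C_\Delta(i,j)$ are edge decomposable. *)

theory Defs
  imports Main
begin

subsection \<open>Multicomplexes\<close>

text \<open>The monomial \<open>x\<^sub>1^a\<^sub>1 \<cdots> x\<^sub>n^a\<^sub>n\<close> is represented by its exponent vector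
  \<open>a :: nat \<Rightarrow> nat\<close>, which vanishes outside the index range \<open>{1..n}\<close>; divisibility of monomials
  is then the pointwise order on functions.  Only the values of \<open>c\<close> on \<open>{1..n}\<close> matter.\<close>

definition monomials :: "nat \<Rightarrow> (nat \<Rightarrow> nat) \<Rightarrow> (nat \<Rightarrow> nat) set" where
  "monomials n c = {a. (\<forall>i\<in>{1..n}. a i \<le> c i) \<and> (\<forall>i. i \<notin> {1..n} \<longrightarrow> a i = 0)}"

definition multicomplex :: "nat \<Rightarrow> (nat \<Rightarrow> nat) \<Rightarrow> (nat \<Rightarrow> nat) set \<Rightarrow> bool" where
  "multicomplex n c M \<longleftrightarrow>
     M \<noteq> {} \<and> M \<subseteq> monomials n c \<and> (\<forall>a\<in>M. \<forall>b. b \<le> a \<longrightarrow> b \<in> M)"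

definition proper_multicomplex :: "nat \<Rightarrow> (nat \<Rightarrow> nat) \<Rightarrow> (nat \<Rightarrow> nat) set \<Rightarrow> bool" where
  "proper_multicomplex n c M \<longleftrightarrow> multicomplex n c M \<and> M \<noteq> monomials n c"


subsection \<open>Simplicial complexes\<close>

definition simplicial_complex :: "'a set set \<Rightarrow> bool" where
  "simplicial_complex \<Delta> \<longleftrightarrow>
     finite (\<Union>\<Delta>) \<and> {} \<in> \<Delta> \<and> (\<forall>F\<in>\<Delta>. \<forall>G. G \<subseteq> F \<longrightarrow> G \<in> \<Delta>)"

definition facets :: "'a set set \<Rightarrow> 'a set set" where
  "facets \<Delta> = {F \<in> \<Delta>. \<forall>G\<in>\<Delta>. F \<subseteq> G \<longrightarrow> G = F}"

definition pure_complex :: "'a set set \<Rightarrow> bool" where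
  "pure_complex \<Delta> \<longleftrightarrow>
     simplicial_complex \<Delta> \<and> (\<forall>F\<in>facets \<Delta>. \<forall>G\<in>facets \<Delta>. card F = card G)"

definition complex_generated_by :: "'a set set \<Rightarrow> 'a set set" where
  "complex_generated_by \<F> = {G. \<exists>F\<in>\<F>. G \<subseteq> F}"

text \<open>The largest face cardinality \<open>d\<close> of a \<open>(d - 1)\<close>-dimensional complex.\<close>

definition complex_rank :: "'a set set \<Rightarrow> nat" where
  "complex_rank \<Delta> = Max (card ` \<Delta>)"

definition boundary_complex :: "'a set set \<Rightarrow> 'a set set" where
  "boundary_complex B = complex_generated_by
     {R \<in> B. card R + 1 = complex_rank B \<and> (\<exists>!F. F \<in> facets B \<and> R \<subseteq> F)}"

definition link :: "'a set set \<Rightarrow> 'a set \<Rightarrow> 'a set set" where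
  "link \<Delta> F = {G. G \<subseteq> \<Union>\<Delta> - F \<and> G \<union> F \<in> \<Delta>}"

definition contraction :: "'a set set \<Rightarrow> 'a \<Rightarrow> 'a \<Rightarrow> 'a set set" where
  "contraction \<Delta> i j = {F \<in> \<Delta>. i \<notin> F} \<union> {(F - {i}) \<union> {j} | F. F \<in> \<Delta> \<and> i \<in> F}"

definition link_condition :: "'a set set \<Rightarrow> 'a \<Rightarrow> 'a \<Rightarrow> bool" where
  "link_condition \<Delta> i j \<longleftrightarrow> link \<Delta> {i} \<inter> link \<Delta> {j} = link \<Delta> {i, j}"

inductive edge_decomposable :: "'a set set \<Rightarrow> bool" where
  empty_face: "edge_decomposable {{}}"
| simplex_boundary: "finite S \<Longrightarrow> S \<noteq> {} \<Longrightarrow> edge_decomposable {F. F \<subset> S}"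
| contract_edge: "pure_complex \<Delta> \<Longrightarrow> i \<noteq> j \<Longrightarrow> {i, j} \<in> \<Delta> \<Longrightarrow> link_condition \<Delta> i j \<Longrightarrow>
    edge_decomposable (link \<Delta> {i, j}) \<Longrightarrow> edge_decomposable (contraction \<Delta> i j) \<Longrightarrow>
    edge_decomposable \<Delta>"


subsection \<open>Generalized Bier spheres\<close>

text \<open>The symbol \<open>x\<^sub>i\<^bsup>(j)\<^esup>\<close> is represented by the pair \<open>(i, j)\<close>.\<close>

definition bier_vertices :: "nat \<Rightarrow> (nat \<Rightarrow> nat) \<Rightarrow> (nat \<times> nat) set" where
  "bier_vertices n c = {(i, j). i \<in> {1..n} \<and> j \<le> c i}"

definition bier_facet :: "nat \<Rightarrow> (nat \<Rightarrow> nat) \<Rightarrow> (nat \<Rightarrow> nat) \<Rightarrow> (nat \<times> nat) set" where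
  "bier_facet n c a = bier_vertices n c - {(i, a i) | i. i \<in> {1..n}}"

definition bier_ball :: "nat \<Rightarrow> (nat \<Rightarrow> nat) \<Rightarrow> (nat \<Rightarrow> nat) set \<Rightarrow> (nat \<times> nat) set set" where
  "bier_ball n c M = complex_generated_by (bier_facet n c ` M)"

definition Bier :: "nat \<Rightarrow> (nat \<Rightarrow> nat) \<Rightarrow> (nat \<Rightarrow> nat) set \<Rightarrow> (nat \<times> nat) set set" where
  "Bier n c M = boundary_complex (bier_ball n c M)"

end

theory Submission
  imports Defs
begin

text \<open>A set of vertices is a face of \<open>Bier n c M\<close> iff its complement contains the transversal
  \<open>{(i, a i)}\<close> of some \<open>a \<in> M\<close> and that of some monomial outside \<open>M\<close>.  In these terms, contracting
  \<open>(n, 0)\<close> onto \<open>(n - 1, c (n - 1))\<close> glues the last two chains end to end and yields the Bier sphere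
  of a multicomplex in \<open>n - 1\<close> variables, while the link of this edge is the Bier sphere obtained by
  deleting the two vertices from their chains.  The link condition holds because lowering \<open>a\<close> at
  \<open>n - 1\<close> keeps it in \<open>M\<close> and raising \<open>b\<close> at \<open>n\<close> keeps it out.  When one of the two symbols is not a
  vertex of the sphere, the gluing map is already an isomorphism.  For \<open>n = 1\<close> the sphere is
  a join of two simplex boundaries.\<close>

section \<open>Simplicial complexes\<close>

lemma facetsD: "F \<in> facets \<Delta> \<Longrightarrow> F \<in> \<Delta>" "F \<in> facets \<Delta> \<Longrightarrow> G \<in> \<Delta> \<Longrightarrow> F \<subseteq> G \<Longrightarrow> G = F"
  by (auto simp: facets_def)

lemma simplicial_complex_down: "simplicial_complex \<Delta> \<Longrightarrow> F \<in> \<Delta> \<Longrightarrow> G \<subseteq> F \<Longrightarrow> G \<in> \<Delta>"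
  by (auto simp: simplicial_complex_def)

lemma link_eq: "simplicial_complex \<Delta> \<Longrightarrow> link \<Delta> F = {G. G \<inter> F = {} \<and> G \<union> F \<in> \<Delta>}"
  unfolding link_def by (auto intro: simplicial_complex_down)

text \<open>As the image under the vertex map identifying \<open>i\<close> with \<open>j\<close>, a
  contraction can be composed with other vertex maps: any map that already sends \<open>i\<close>
  and \<open>j\<close> to the same point has the same image on the contraction as on
  \<open>\<Delta>\<close>.\<close>

lemma contraction_eq_image: "contraction \<Delta> i j = (`) (id(i := j)) ` \<Delta>"
proof -
  have img: "(id(i := j)) ` F = (if i \<in> F then (F - {i}) \<union> {j} else F)" for F
    by (auto simp: image_iff)
  show ?thesis
    unfolding contraction_def
  proof (intro equalityI subsetI)
    fix G assume "G \<in> {F \<in> \<Delta>. i \<notin> F} \<union> {F - {i} \<union> {j} |F. F \<in> \<Delta> \<and> i \<in> F}"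
    then obtain F where "F \<in> \<Delta>" "G = (if i \<in> F then (F - {i}) \<union> {j} else F)" by auto
    then show "G \<in> (`) (id(i := j)) ` \<Delta>" using img by blast
  next
    fix G assume "G \<in> (`) (id(i := j)) ` \<Delta>"
    then obtain F where F: "F \<in> \<Delta>" "G = (id(i := j)) ` F" by auto
    then show "G \<in> {F \<in> \<Delta>. i \<notin> F} \<union> {F - {i} \<union> {j} |F. F \<in> \<Delta> \<and> i \<in> F}"
      using img[of F] by (cases "i \<in> F") auto
  qed
qed

section \<open>Transport of complexes along vertex maps\<close>

lemma simplicial_complex_image:
  assumes "simplicial_complex \<Delta>"
  shows "simplicial_complex ((`) f ` \<Delta>)"
  unfolding simplicial_complex_def
proof (intro conjI ballI allI impI)
  have "\<Union>((`) f ` \<Delta>) = f ` \<Union>\<Delta>" by auto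
  then show "finite (\<Union>((`) f ` \<Delta>))" using assms by (simp add: simplicial_complex_def)
  show "{} \<in> (`) f ` \<Delta>" using assms by (force simp: simplicial_complex_def)
next
  fix F G assume "F \<in> (`) f ` \<Delta>" "G \<subseteq> F"
  then obtain F0 where F0: "F0 \<in> \<Delta>" "G \<subseteq> f ` F0" by auto
  then obtain G0 where "G0 \<subseteq> F0" "G = f ` G0" by (auto simp: subset_image_iff)
  then show "G \<in> (`) f ` \<Delta>" using assms F0 by (auto intro: simplicial_complex_down)
qed

lemma facets_imageE:
  assumes "inj_on f (\<Union>\<Delta>)" "F \<in> facets ((`) f ` \<Delta>)"
  obtains F0 where "F0 \<in> facets \<Delta>" "F = f ` F0"
proof -
  obtain F0 where F0: "F0 \<in> \<Delta>" "F = f ` F0" using assms(2) by (auto dest: facetsD(1))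
  have "G = F0" if G: "G \<in> \<Delta>" "F0 \<subseteq> G" for G
  proof -
    have "f ` G = f ` F0"
      using assms(2) F0 G by (auto dest!: facetsD(2)[of _ _ "f ` G"])
    then show ?thesis using assms(1) F0 G by (metis Union_upper inj_on_image_eq_iff)
  qed
  then have "F0 \<in> facets \<Delta>" using F0 by (auto simp: facets_def)
  then show thesis using that F0 by simp
qed

lemma pure_complex_image:
  assumes "pure_complex \<Delta>" "inj_on f (\<Union>\<Delta>)"
  shows "pure_complex ((`) f ` \<Delta>)"
proof -
  have card_eq: "card (f ` F) = card F" if "F \<in> facets \<Delta>" for F
  proof -
    have "F \<subseteq> \<Union>\<Delta>" using facetsD(1)[OF that] by auto
    then show ?thesis using assms(2) by (intro card_image) (rule inj_on_subset)
  qed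
  have "card F = card G" if FG: "F \<in> facets ((`) f ` \<Delta>)" "G \<in> facets ((`) f ` \<Delta>)" for F G
  proof -
    obtain F0 where F0: "F0 \<in> facets \<Delta>" "F = f ` F0" using facets_imageE[OF assms(2) FG(1)] .
    obtain G0 where G0: "G0 \<in> facets \<Delta>" "G = f ` G0" using facets_imageE[OF assms(2) FG(2)] .
    have "card F0 = card G0" using F0 G0 assms(1) unfolding pure_complex_def by blast
    then show ?thesis using card_eq F0 G0 by metis
  qed
  moreover have "simplicial_complex ((`) f ` \<Delta>)"
    using assms(1) unfolding pure_complex_def by (blast intro: simplicial_complex_image)
  ultimately show ?thesis unfolding pure_complex_def by (intro conjI ballI)
qed

lemma link_image:
  assumes "simplicial_complex \<Delta>" "inj_on f (\<Union>\<Delta>)" "S \<in> \<Delta>"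
  shows "link ((`) f ` \<Delta>) (f ` S) = (`) f ` link \<Delta> S"
proof (intro equalityI subsetI)
  fix G assume "G \<in> link ((`) f ` \<Delta>) (f ` S)"
  then obtain F where F: "F \<in> \<Delta>" "G \<union> f ` S = f ` F" "G \<inter> f ` S = {}"
    using assms(1) by (auto simp: link_eq simplicial_complex_image)
  \<comment> \<open>Only an inclusion of images is given; injectivity on the vertices pulls it
    back.\<close>
  have sub: "S \<subseteq> F"
  proof
    fix x assume "x \<in> S"
    then have "f x \<in> f ` F" using F(2) by blast
    then obtain y where "y \<in> F" "f x = f y" by auto
    then show "x \<in> F" using assms(2,3) F(1) \<open>x \<in> S\<close> by (metis UnionI inj_onD)
  qed
  have "f ` (F - S) = f ` F - f ` S"
    using assms(2) F(1) sub by (intro inj_on_image_set_diff[of f "\<Union>\<Delta>"]) auto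
  then have "G = f ` (F - S)" using F by auto
  moreover have "F - S \<in> link \<Delta> S"
    using F sub assms(1) by (auto simp: link_eq Un_absorb2)
  ultimately show "G \<in> (`) f ` link \<Delta> S" by blast
next
  fix G assume "G \<in> (`) f ` link \<Delta> S"
  then obtain G0 where G0: "G = f ` G0" "G0 \<inter> S = {}" "G0 \<union> S \<in> \<Delta>"
    using assms(1) by (auto simp: link_eq)
  have "f ` G0 \<inter> f ` S = f ` (G0 \<inter> S)"
    using G0 assms(2) by (intro inj_on_image_Int[symmetric, of f "\<Union>\<Delta>"]) auto
  then show "G \<in> link ((`) f ` \<Delta>) (f ` S)"
    using G0 assms(1) by (auto simp: link_eq simplicial_complex_image image_Un[symmetric])
qed

text \<open>A vertex mapped to \<open>f i\<close> must be \<open>i\<close> itself, so redirecting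
  \<open>f i\<close> to \<open>f j\<close> after \<open>f\<close> agrees with redirecting
  \<open>i\<close> to \<open>j\<close> before it.\<close>

lemma contraction_image:
  assumes "inj_on f (\<Union>\<Delta>)" "i \<in> \<Union>\<Delta>"
  shows "contraction ((`) f ` \<Delta>) (f i) (f j) = (`) f ` contraction \<Delta> i j"
proof -
  have "(id(f i := f j)) ` f ` F = f ` (id(i := j)) ` F" if "F \<in> \<Delta>" for F
    unfolding image_image
    by (rule image_cong) (use assms that in \<open>auto dest: inj_onD\<close>)
  then show ?thesis
    unfolding contraction_eq_image by (simp add: image_image[of "(`) _"] del: fun_upd_apply cong: image_cong)
qed

lemma Union_contraction_subset: "\<Union>(contraction \<Delta> i j) \<subseteq> insert j (\<Union>\<Delta> - {i})" if "i \<noteq> j"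
  using that unfolding contraction_def by auto

text \<open>The vertices of the link and of the contraction are vertices of \<open>\<Delta>\<close>,
  so injectivity passes down the decomposition, and link, contraction and link condition all commute
  with the image.\<close>

lemma edge_decomposable_image:
  assumes "edge_decomposable \<Delta>" "inj_on f (\<Union>\<Delta>)"
  shows "edge_decomposable ((`) f ` \<Delta>)"
  using assms
proof induction
  case empty_face
  then show ?case by (simp add: edge_decomposable.empty_face)
next
  case (simplex_boundary S)
  \<comment> \<open>The boundary of a one-point simplex has no vertices, so there the injectivity
    assumption says nothing about \<open>S\<close>; otherwise the vertex set of the boundary is
    \<open>S\<close>.\<close>
  have inj: "card S \<noteq> 1 \<Longrightarrow> inj_on f S"
  proof -
    assume "card S \<noteq> 1"
    then have "\<exists>y\<in>S. y \<noteq> x" if "x \<in> S" for x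
      using that by (metis is_singletonI' is_singleton_altdef empty_iff)
    then have "{x} \<subset> S" if "x \<in> S" for x using that by blast
    then have "\<Union>{F. F \<subset> S} = S" by blast
    then show ?thesis using simplex_boundary by simp
  qed
  show ?case
  proof (cases "card S = 1")
    case True
    then obtain x where "S = {x}" by (auto simp: card_1_singleton_iff)
    then have "{F. F \<subset> S} = {{}}" by auto
    then show ?thesis by (simp add: edge_decomposable.empty_face)
  next
    case False
    then have injS: "inj_on f S" using inj by simp
    have "(`) f ` {F. F \<subset> S} = {F. F \<subset> f ` S}"
    proof (intro equalityI subsetI)
      fix G assume "G \<in> (`) f ` {F. F \<subset> S}"
      then show "G \<in> {F. F \<subset> f ` S}" using injS by (auto simp: psubset_eq inj_on_image_eq_iff)
    next
      fix G assume "G \<in> {F. F \<subset> f ` S}"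
      then obtain F where "F \<subseteq> S" "G = f ` F" "G \<noteq> f ` S"
        by (metis mem_Collect_eq psubset_eq subset_image_iff)
      then show "G \<in> (`) f ` {F. F \<subset> S}" by blast
    qed
    then show ?thesis
      using simplex_boundary by (simp add: edge_decomposable.simplex_boundary)
  qed
next
  case (contract_edge \<Delta> i j)
  have sc: "simplicial_complex \<Delta>" using contract_edge.hyps(1) by (simp add: pure_complex_def)
  have ij: "i \<in> \<Union>\<Delta>" "j \<in> \<Union>\<Delta>" and sing: "{i} \<in> \<Delta>" "{j} \<in> \<Delta>"
    using contract_edge.hyps(3) sc by (auto intro: simplicial_complex_down)
  note inj = contract_edge.prems
  have sub: "link \<Delta> S \<subseteq> \<Delta>" for S using sc by (auto simp: link_eq intro: simplicial_complex_down)
  have "\<Union>(contraction \<Delta> i j) \<subseteq> \<Union>\<Delta>"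
    using Union_contraction_subset[OF contract_edge.hyps(2)] ij by fastforce
  then have ed_c: "edge_decomposable ((`) f ` contraction \<Delta> i j)"
    using contract_edge.IH(2) inj by (meson inj_on_subset)
  have ed_l: "edge_decomposable ((`) f ` link \<Delta> {i, j})"
    using contract_edge.IH(1) inj sub by (meson Union_mono inj_on_subset)
  note li = link_image[OF sc inj contract_edge.hyps(3)] link_image[OF sc inj sing(1)]
    link_image[OF sc inj sing(2)]
  \<comment> \<open>Distinct faces have distinct images, so taking images commutes with intersecting
    the two vertex links.\<close>
  have "inj_on ((`) f) \<Delta>"
    using inj_on_image_eq_iff[OF inj] by (meson Union_upper inj_onI)
  then have "(`) f ` (link \<Delta> {i} \<inter> link \<Delta> {j}) = (`) f ` link \<Delta> {i} \<inter> (`) f ` link \<Delta> {j}"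
    using sub by (intro inj_on_image_Int) auto
  then have lc: "link_condition ((`) f ` \<Delta>) (f i) (f j)"
    using contract_edge.hyps(4) li by (simp add: link_condition_def)
  show ?case
  proof (rule edge_decomposable.contract_edge[of _ "f i" "f j"])
    show "pure_complex ((`) f ` \<Delta>)" using contract_edge.hyps(1) inj by (rule pure_complex_image)
    show "f i \<noteq> f j" using inj ij contract_edge.hyps(2) by (auto dest: inj_onD)
    show "{f i, f j} \<in> (`) f ` \<Delta>" using contract_edge.hyps(3) by (auto intro!: image_eqI[of _ _ "{i, j}"])
    show "edge_decomposable (link ((`) f ` \<Delta>) {f i, f j})" using ed_l li by simp
    show "edge_decomposable (contraction ((`) f ` \<Delta>) (f i) (f j))"
      using ed_c inj ij by (simp add: contraction_image)
  qed (fact lc)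
qed

lemma edge_decomposable_image_iff:
  assumes "inj_on f (\<Union>\<Delta>)"
  shows "edge_decomposable ((`) f ` \<Delta>) \<longleftrightarrow> edge_decomposable \<Delta>"
proof
  let ?g = "inv_into (\<Union>\<Delta>) f"
  assume ed: "edge_decomposable ((`) f ` \<Delta>)"
  have "?g ` f ` F = F" if "F \<in> \<Delta>" for F
    using that assms by (intro inv_into_image_cancel) auto
  then have "(`) ?g ` (`) f ` \<Delta> = \<Delta>" by (simp add: image_image)
  moreover have "inj_on ?g (\<Union>((`) f ` \<Delta>))"
    by (rule inj_on_subset[OF inj_on_inv_into[of "f ` \<Union>\<Delta>"]]) auto
  ultimately show "edge_decomposable \<Delta>" using edge_decomposable_image[OF ed] by metis
qed (simp add: edge_decomposable_image assms)

section \<open>Joins of two simplex boundaries\<close>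

text \<open>For disjoint \<open>A\<close> and \<open>B\<close> these are the unions of a proper
  subset of \<open>A\<close> with a proper subset of \<open>B\<close>.\<close>

definition boundary_join :: "'a set \<Rightarrow> 'a set \<Rightarrow> 'a set set" where
  "boundary_join A B = {F. F \<subseteq> A \<union> B \<and> \<not> A \<subseteq> F \<and> \<not> B \<subseteq> F}"

lemma boundary_join_commute: "boundary_join A B = boundary_join B A"
  by (auto simp: boundary_join_def)

lemma simplicial_complex_boundary_join:
  assumes "finite A" "finite B" "A \<noteq> {}" "B \<noteq> {}"
  shows "simplicial_complex (boundary_join A B)"
  unfolding simplicial_complex_def
proof (intro conjI)
  have "\<Union>(boundary_join A B) \<subseteq> A \<union> B" by (auto simp: boundary_join_def)
  then show "finite (\<Union>(boundary_join A B))" using assms finite_subset by blast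
qed (use assms in \<open>auto simp: boundary_join_def\<close>)

lemma pure_complex_boundary_join:
  assumes "finite A" "finite B" "A \<noteq> {}" "B \<noteq> {}" "A \<inter> B = {}"
  shows "pure_complex (boundary_join A B)"
proof -
  have "card F = card (A \<union> B) - 2" if F: "F \<in> facets (boundary_join A B)" for F
  proof -
    \<comment> \<open>Removing just one missed vertex from each side gives a face containing
      \<open>F\<close>, so a facet misses exactly these two.\<close>
    obtain u v where uv: "u \<in> A" "v \<in> B" "u \<notin> F" "v \<notin> F" and "F \<subseteq> A \<union> B"
      using facetsD(1)[OF F] by (auto simp: boundary_join_def)
    then have "A \<union> B - {u, v} = F"
      by (intro facetsD(2)[OF F]) (auto simp: boundary_join_def)
    moreover have "card (A \<union> B - {u, v}) = card (A \<union> B) - card {u, v}"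
      using uv by (intro card_Diff_subset) auto
    moreover have "u \<noteq> v" using uv assms by auto
    ultimately show ?thesis by simp
  qed
  then show ?thesis
    using simplicial_complex_boundary_join assms by (simp add: pure_complex_def)
qed

text \<open>Contract an edge from \<open>u\<close> in \<open>A\<close> to \<open>v\<close> in
  \<open>B\<close>. Its link is the join for \<open>A - {u}\<close> and \<open>B - {v}\<close>, and
  the contraction is the boundary of the simplex on \<open>A \<union> B - {u}\<close>. If one side
  is a single point, its boundary is \<open>{{}}\<close> and the join is already a simplex
  boundary.\<close>

lemma edge_decomposable_boundary_join:
  assumes "finite A" "finite B" "A \<noteq> {}" "B \<noteq> {}" "A \<inter> B = {}"
  shows "edge_decomposable (boundary_join A B)"
  using assms
proof (induction "card A" arbitrary: A B rule: less_induct)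
  case less
  have single: "edge_decomposable (boundary_join {u} D)" if "finite D" "D \<noteq> {}" "u \<notin> D" for u :: 'a and D
  proof -
    have "boundary_join {u} D = {F. F \<subset> D}" using that by (auto simp: boundary_join_def)
    then show ?thesis using that by (simp add: edge_decomposable.simplex_boundary)
  qed
  obtain u v where uv: "u \<in> A" "v \<in> B" using less.prems by auto
  show ?case
  proof (cases "A = {u} \<or> B = {v}")
    case True
    then show ?thesis
    proof
      assume "A = {u}"
      then show ?thesis using single[of B u] less.prems by simp
    next
      assume B: "B = {v}"
      then have "edge_decomposable (boundary_join {v} A)" using single[of A v] less.prems by simp
      then show ?thesis using B by (simp add: boundary_join_commute)
    qed
  next
    case False
    then have ne: "A - {u} \<noteq> {}" "B - {v} \<noteq> {}" using uv by auto
    have sc: "simplicial_complex (boundary_join A B)"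
      using less.prems by (intro simplicial_complex_boundary_join)
    have uv_ne: "u \<noteq> v" "u \<notin> B" "v \<notin> A" using uv less.prems by auto
    have lk: "link (boundary_join A B) {u, v} = boundary_join (A - {u}) (B - {v})"
      unfolding link_eq[OF sc] using uv uv_ne by (auto simp: boundary_join_def)
    have co: "contraction (boundary_join A B) u v = {F. F \<subset> A \<union> B - {u}}"
    proof (intro equalityI subsetI)
      fix G assume "G \<in> contraction (boundary_join A B) u v"
      then show "G \<in> {F. F \<subset> A \<union> B - {u}}"
        using uv uv_ne by (auto simp: contraction_def boundary_join_def)
    next
      fix G assume "G \<in> {F. F \<subset> A \<union> B - {u}}"
      then obtain x where G: "G \<subseteq> A \<union> B - {u}" "x \<in> A \<union> B" "x \<noteq> u" "x \<notin> G" by auto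
      show "G \<in> contraction (boundary_join A B) u v"
      proof (cases "B \<subseteq> G")
        case False
        then have "G \<in> boundary_join A B" "u \<notin> G"
          using G uv by (auto simp: boundary_join_def)
        then show ?thesis by (simp add: contraction_def)
      next
        case True
        \<comment> \<open>Without \<open>v\<close> the set no longer contains \<open>B\<close>. The
          missing point \<open>x\<close> must lie in \<open>A\<close>, because \<open>G\<close>
          contains \<open>B\<close>, and it keeps \<open>A\<close> from being contained.\<close>
        then have "insert u (G - {v}) \<in> boundary_join A B"
          using G uv uv_ne by (auto simp: boundary_join_def)
        moreover have "G = (insert u (G - {v}) - {u}) \<union> {v}" using True uv uv_ne G by auto
        ultimately show ?thesis unfolding contraction_def by blast
      qed
    qed
    show ?thesis
    proof (rule edge_decomposable.contract_edge[of _ u v])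
      show "pure_complex (boundary_join A B)"
        using less.prems by (intro pure_complex_boundary_join)
      show "{u, v} \<in> boundary_join A B" using ne uv uv_ne by (auto simp: boundary_join_def)
      show "link_condition (boundary_join A B) u v"
        unfolding link_condition_def link_eq[OF sc]
        using uv uv_ne by (auto simp: boundary_join_def)
      show "edge_decomposable (link (boundary_join A B) {u, v})"
        unfolding lk using less.prems ne uv
        by (intro less.hyps) (auto simp: card_gt_0_iff)
      show "edge_decomposable (contraction (boundary_join A B) u v)"
        unfolding co using less.prems ne by (intro edge_decomposable.simplex_boundary) auto
    qed (fact uv_ne(1))
  qed
qed


section \<open>Faces of generalized Bier spheres\<close>

text \<open>The first witness puts \<open>G\<close> into the ball of \<open>M\<close>, the second
  into the complex generated by the facets of the monomials outside \<open>M\<close>; the sphere is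
  the intersection of these two complexes.\<close>

definition bier_faces :: "nat \<Rightarrow> (nat \<Rightarrow> nat) \<Rightarrow> (nat \<Rightarrow> nat) set \<Rightarrow> (nat \<times> nat) set set" where
  "bier_faces n c M = {G. G \<subseteq> bier_vertices n c \<and>
     (\<exists>a\<in>M. \<forall>i\<in>{1..n}. (i, a i) \<notin> G) \<and> (\<exists>b\<in>monomials n c - M. \<forall>i\<in>{1..n}. (i, b i) \<notin> G)}"

lemma bier_facesI:
  assumes "G \<subseteq> bier_vertices n c" "a \<in> M" "b \<in> monomials n c" "b \<notin> M"
    "\<And>i. i \<in> {1..n} \<Longrightarrow> (i, a i) \<notin> G" "\<And>i. i \<in> {1..n} \<Longrightarrow> (i, b i) \<notin> G"
  shows "G \<in> bier_faces n c M"
  using assms unfolding bier_faces_def by blast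

lemma bier_facesE:
  assumes "G \<in> bier_faces n c M"
  obtains a b where "G \<subseteq> bier_vertices n c" "a \<in> M" "b \<in> monomials n c" "b \<notin> M"
    "\<And>i. i \<in> {1..n} \<Longrightarrow> (i, a i) \<notin> G" "\<And>i. i \<in> {1..n} \<Longrightarrow> (i, b i) \<notin> G"
  using assms unfolding bier_faces_def by blast

section \<open>Monomials and multicomplexes\<close>

lemma monomials_le: "a \<in> monomials n c \<Longrightarrow> i \<in> {1..n} \<Longrightarrow> a i \<le> c i"
  by (simp add: monomials_def)

lemma monomials_down:
  assumes "a \<in> monomials n c" "b \<le> a"
  shows "b \<in> monomials n c"
  unfolding monomials_def
proof (intro CollectI conjI ballI allI impI)
  fix i
  have "b i \<le> a i" using assms(2) by (rule le_funD)
  then show "b i \<le> c i" if "i \<in> {1..n}" using monomials_le[OF assms(1) that] by simp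
  show "b i = 0" if "i \<notin> {1..n}" using \<open>b i \<le> a i\<close> that assms(1) by (simp add: monomials_def)
qed

lemma monomials_update: "a \<in> monomials n c \<Longrightarrow> i \<in> {1..n} \<Longrightarrow> j \<le> c i \<Longrightarrow> a(i := j) \<in> monomials n c"
  by (simp add: monomials_def)

lemma monomials_eqI:
  assumes "a \<in> monomials n c" "b \<in> monomials n c" "\<And>i. i \<in> {1..n} \<Longrightarrow> a i = b i"
  shows "a = b"
proof
  fix i show "a i = b i" using assms by (cases "i \<in> {1..n}") (auto simp: monomials_def)
qed

lemma multicomplex_down: "multicomplex n c M \<Longrightarrow> a \<in> M \<Longrightarrow> b \<le> a \<Longrightarrow> b \<in> M"
  by (auto simp: multicomplex_def)

lemma multicomplex_monomials: "multicomplex n c M \<Longrightarrow> a \<in> M \<Longrightarrow> a \<in> monomials n c"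
  by (auto simp: multicomplex_def)

section \<open>Facets and ridges of the ball\<close>

lemma finite_bier_vertices: "finite (bier_vertices n c)"
proof -
  have "bier_vertices n c = (SIGMA i:{1..n}. {..c i})" by (auto simp: bier_vertices_def)
  then show ?thesis by simp
qed

lemma subset_bier_facet_iff:
  "G \<subseteq> bier_facet n c a \<longleftrightarrow> G \<subseteq> bier_vertices n c \<and> (\<forall>i\<in>{1..n}. (i, a i) \<notin> G)"
  by (auto simp: bier_facet_def)

lemma card_bier_facet:
  assumes "a \<in> monomials n c"
  shows "card (bier_facet n c a) + n = card (bier_vertices n c)"
proof -
  let ?T = "(\<lambda>i. (i, a i)) ` {1..n}"
  have T: "?T \<subseteq> bier_vertices n c" using monomials_le[OF assms] by (auto simp: bier_vertices_def)
  have "card ?T = n" by (simp add: card_image inj_on_def)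
  moreover have "bier_facet n c a = bier_vertices n c - ?T" by (auto simp: bier_facet_def)
  ultimately show ?thesis
    using T card_Diff_subset[OF _ T] card_mono[OF finite_bier_vertices T] by simp
qed

text \<open>In each chain a Bier facet misses exactly one vertex, so an inclusion forces the missed
  vertices to agree.\<close>

lemma bier_facet_inj:
  assumes "a \<in> monomials n c" "b \<in> monomials n c" "bier_facet n c a \<subseteq> bier_facet n c b"
  shows "a = b"
proof (rule monomials_eqI[OF assms(1,2)])
  fix i assume i: "i \<in> {1..n}"
  then have "(i, b i) \<notin> bier_facet n c a" "(i, b i) \<in> bier_vertices n c"
    using assms monomials_le[OF assms(2)] by (auto simp: bier_facet_def bier_vertices_def)
  then show "a i = b i" by (auto simp: bier_facet_def)
qed

lemma facets_bier_ball:
  assumes "M \<subseteq> monomials n c"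
  shows "facets (bier_ball n c M) = bier_facet n c ` M"
proof (intro equalityI subsetI)
  fix F assume F: "F \<in> facets (bier_ball n c M)"
  then obtain a where a: "a \<in> M" "F \<subseteq> bier_facet n c a"
    by (auto simp: bier_ball_def complex_generated_by_def dest!: facetsD(1))
  then have "bier_facet n c a = F"
    by (intro facetsD(2)[OF F]) (auto simp: bier_ball_def complex_generated_by_def)
  then show "F \<in> bier_facet n c ` M" using a by auto
next
  fix F assume "F \<in> bier_facet n c ` M"
  then obtain a where a: "a \<in> M" "F = bier_facet n c a" by auto
  have "G = F" if G: "G \<in> bier_ball n c M" "F \<subseteq> G" for G
  proof -
    obtain b where b: "b \<in> M" "G \<subseteq> bier_facet n c b"
      using G by (auto simp: bier_ball_def complex_generated_by_def)
    then have "a = b" using a G assms by (intro bier_facet_inj[of a n c b]) auto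
    then show ?thesis using a b G by simp
  qed
  moreover have "F \<in> bier_ball n c M" using a by (auto simp: bier_ball_def complex_generated_by_def)
  ultimately show "F \<in> facets (bier_ball n c M)" by (auto simp: facets_def)
qed

lemma complex_rank_bier_ball:
  assumes "M \<subseteq> monomials n c" "M \<noteq> {}"
  shows "complex_rank (bier_ball n c M) = card (bier_vertices n c) - n"
  unfolding complex_rank_def
proof (rule Max_eqI)
  have "bier_ball n c M \<subseteq> Pow (bier_vertices n c)"
    by (auto simp: bier_ball_def complex_generated_by_def bier_facet_def)
  then show "finite (card ` bier_ball n c M)"
    using finite_bier_vertices by (metis finite_Pow_iff finite_imageI finite_subset)
next
  fix y assume "y \<in> card ` bier_ball n c M"
  then obtain a F where aF: "a \<in> M" "F \<subseteq> bier_facet n c a" "y = card F"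
    by (auto simp: bier_ball_def complex_generated_by_def)
  have "finite (bier_facet n c a)" by (simp add: bier_facet_def finite_bier_vertices)
  then have "y \<le> card (bier_facet n c a)" using aF by (simp add: card_mono)
  then show "y \<le> card (bier_vertices n c) - n" using card_bier_facet[of a n c] aF assms by auto
next
  obtain a where a: "a \<in> M" using assms by auto
  then have "card (bier_facet n c a) = card (bier_vertices n c) - n"
    using card_bier_facet[of a n c] assms by auto
  moreover have "bier_facet n c a \<in> bier_ball n c M"
    using a by (auto simp: bier_ball_def complex_generated_by_def)
  ultimately show "card (bier_vertices n c) - n \<in> card ` bier_ball n c M" by (metis imageI)
qed

text \<open>The ridge misses only \<open>(l, a l)\<close> in a chain \<open>l\<close> other than
  \<open>i\<close>, and only \<open>(i, a i)\<close> and \<open>(i, j)\<close> in chain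
  \<open>i\<close>; this leaves two choices for \<open>a'\<close>.\<close>

lemma bier_facet_minus_vertex_subset:
  assumes "a \<in> monomials n c" "i \<in> {1..n}" "j \<le> c i" "a' \<in> monomials n c"
    "bier_facet n c a - {(i, j)} \<subseteq> bier_facet n c a'"
  shows "a' = a \<or> a' = a(i := j)"
proof -
  have *: "a' l = a l \<or> l = i \<and> a' l = j" if l: "l \<in> {1..n}" for l
  proof -
    have "(l, a' l) \<notin> bier_facet n c a - {(i, j)}" "(l, a' l) \<in> bier_vertices n c"
      using assms l monomials_le[OF assms(4)] by (auto simp: bier_facet_def bier_vertices_def)
    then show ?thesis by (auto simp: bier_facet_def)
  qed
  show ?thesis
  proof (cases "a' i = a i")
    case True
    then have "a' = a" using * by (intro monomials_eqI[OF assms(4,1)]) metis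
    then show ?thesis ..
  next
    case False
    then have "a' = a(i := j)"
      using * assms(2) by (intro monomials_eqI[OF assms(4) monomials_update[OF assms(1-3)]])
        (metis fun_upd_apply)
    then show ?thesis ..
  qed
qed

text \<open>Replacing the coordinates of \<open>a\<close> by those of \<open>b\<close> one at a time leaves \<open>M\<close> at some step.\<close>

lemma bier_faces_subset_ridge:
  assumes "multicomplex n c M" "G \<in> bier_faces n c M"
  obtains a i j where "a \<in> M" "i \<in> {1..n}" "j \<le> c i" "a(i := j) \<notin> M"
    "G \<subseteq> bier_facet n c a - {(i, j)}"
proof -
  obtain a b where ab: "G \<subseteq> bier_vertices n c" "a \<in> M" "b \<in> monomials n c" "b \<notin> M"
    "\<And>i. i \<in> {1..n} \<Longrightarrow> (i, a i) \<notin> G" "\<And>i. i \<in> {1..n} \<Longrightarrow> (i, b i) \<notin> G"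
    using assms(2) by (rule bier_facesE) blast
  have amon: "a \<in> monomials n c" using assms(1) ab(2) by (rule multicomplex_monomials)
  define e where "e t = (\<lambda>i. if i \<le> t then b i else a i)" for t
  have "e 0 = a" using ab(3) amon by (auto simp: e_def monomials_def)
  moreover have "e n = b" using ab(3) amon by (auto simp: e_def monomials_def)
  ultimately obtain t where t: "t < n" "e t \<in> M" "e (Suc t) \<notin> M"
    using ab(2,4) ex_least_nat_less[of "\<lambda>t. e t \<notin> M" n] by auto
  have "e (Suc t) = (e t)(Suc t := b (Suc t))" by (auto simp: e_def fun_eq_iff le_Suc_eq)
  \<comment> \<open>Every coordinate of \<open>e t\<close> comes from \<open>a\<close> or
    \<open>b\<close>, and both transversals avoid \<open>G\<close>.\<close>
  moreover have "G \<subseteq> bier_facet n c (e t)"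
    unfolding subset_bier_facet_iff using ab by (simp add: e_def)
  moreover have "Suc t \<in> {1..n}" using t by simp
  moreover have "G \<subseteq> bier_facet n c (e t) - {(Suc t, b (Suc t))}"
    using calculation ab(6) by blast
  ultimately show ?thesis
    using that[of "e t" "Suc t" "b (Suc t)"] t monomials_le[OF ab(3)] by simp
qed

text \<open>The ridge avoids two transversals: that of \<open>a\<close> in \<open>M\<close> and that
  of \<open>a(i := j)\<close> outside \<open>M\<close>.\<close>

lemma bier_ridge_mem_bier_faces:
  assumes "multicomplex n c M" "a \<in> M" "i \<in> {1..n}" "j \<le> c i" "a(i := j) \<notin> M"
  shows "bier_facet n c a - {(i, j)} \<in> bier_faces n c M"
  by (rule bier_facesI[of _ _ _ a _ "a(i := j)"])
    (use assms in \<open>auto simp: bier_facet_def multicomplex_monomials intro!: monomials_update\<close>)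

lemma card_bier_ridge:
  assumes "a \<in> monomials n c" "i \<in> {1..n}" "j \<le> c i" "j \<noteq> a i"
  shows "card (bier_facet n c a - {(i, j)}) + 1 = card (bier_vertices n c) - n"
proof -
  have fin: "finite (bier_facet n c a)" by (simp add: bier_facet_def finite_bier_vertices)
  have "(i, j) \<in> bier_facet n c a" using assms by (auto simp: bier_facet_def bier_vertices_def)
  then have "Suc (card (bier_facet n c a - {(i, j)})) = card (bier_facet n c a)"
    using card.remove fin by metis
  then show ?thesis using card_bier_facet[OF assms(1)] by simp
qed

text \<open>A ridge obtained by removing \<open>(i, j)\<close> from the facet of \<open>a\<close>
  can lie in only one other facet, that of \<open>a(i := j)\<close>. So it is a boundary ridge
  exactly when \<open>a(i := j)\<close> is outside \<open>M\<close>, and these ridges generate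
  \<open>bier_faces\<close>.\<close>

lemma Bier_eq_bier_faces:
  assumes "multicomplex n c M"
  shows "Bier n c M = bier_faces n c M"
proof (intro equalityI subsetI)
  have M: "M \<subseteq> monomials n c" "M \<noteq> {}" using assms by (auto simp: multicomplex_def)
  note simps = facets_bier_ball[OF M(1)] complex_rank_bier_ball[OF M]
  {
    fix G assume "G \<in> Bier n c M"
    then obtain R where R1: "G \<subseteq> R" and
      "R \<in> {R \<in> bier_ball n c M. card R + 1 = complex_rank (bier_ball n c M) \<and>
         (\<exists>!F. F \<in> facets (bier_ball n c M) \<and> R \<subseteq> F)}"
      unfolding Bier_def boundary_complex_def complex_generated_by_def by blast
    then have R: "card R + 1 = card (bier_vertices n c) - n"
      "\<exists>!F. F \<in> bier_facet n c ` M \<and> R \<subseteq> F"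
      by (simp_all only: simps mem_Collect_eq)
    from R(2) have "\<exists>F. F \<in> bier_facet n c ` M \<and> R \<subseteq> F" by (rule ex1_implies_ex)
    then obtain a where a: "a \<in> M" "R \<subseteq> bier_facet n c a" by blast
    then have amon: "a \<in> monomials n c" using M by auto
    \<comment> \<open>Comparing sizes shows that \<open>R\<close> omits some vertex
      \<open>(i, j)\<close> of the facet of \<open>a\<close>.\<close>
    have "card R < card (bier_facet n c a)" using R(1) card_bier_facet[OF amon] by simp
    then have "R \<noteq> bier_facet n c a" by auto
    then obtain i j where ij: "(i, j) \<in> bier_facet n c a" "(i, j) \<notin> R" using a by auto
    then have ij': "i \<in> {1..n}" "j \<le> c i" "j \<noteq> a i" by (auto simp: bier_facet_def bier_vertices_def)
    have sub: "R \<subseteq> bier_facet n c (a(i := j))"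
      using a ij by (auto simp: subset_bier_facet_iff)
    \<comment> \<open>Otherwise \<open>R\<close> would lie in two facets of the ball, those of
      \<open>a\<close> and \<open>a(i := j)\<close>, which differ since
      \<open>j \<noteq> a i\<close>.\<close>
    have "a(i := j) \<notin> M"
    proof
      assume M': "a(i := j) \<in> M"
      then have "bier_facet n c (a(i := j)) = bier_facet n c a" 
        using R(2)[THEN ex1E] a(1,2) sub by (metis imageI)
      then have "a(i := j) = a" using bier_facet_inj amon M M' by (metis order_refl subsetD)
      then show False using ij' by (metis fun_upd_same)
    qed
    then have "bier_facet n c a - {(i, j)} \<in> bier_faces n c M"
      using assms a ij' by (intro bier_ridge_mem_bier_faces)
    moreover have "G \<subseteq> bier_facet n c a - {(i, j)}" using R1 a ij by auto
    ultimately show "G \<in> bier_faces n c M" unfolding bier_faces_def by blast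
  }
  fix G assume "G \<in> bier_faces n c M"
  then obtain a i j where a: "a \<in> M" "i \<in> {1..n}" "j \<le> c i" "a(i := j) \<notin> M"
    and G: "G \<subseteq> bier_facet n c a - {(i, j)}"
    using bier_faces_subset_ridge[OF assms] by blast
  let ?R = "bier_facet n c a - {(i, j)}"
  have amon: "a \<in> monomials n c" using a M by auto
  have "j \<noteq> a i" using a by (metis fun_upd_triv)
  then have "card ?R + 1 = card (bier_vertices n c) - n" using a amon by (intro card_bier_ridge)
  moreover have "?R \<in> bier_ball n c M"
    using a by (auto simp: bier_ball_def complex_generated_by_def)
  moreover have "\<exists>!F. F \<in> bier_facet n c ` M \<and> ?R \<subseteq> F"
  proof (rule ex1I[of _ "bier_facet n c a"])
    fix F assume "F \<in> bier_facet n c ` M \<and> ?R \<subseteq> F"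
    then obtain a' where a': "a' \<in> M" "F = bier_facet n c a'" "?R \<subseteq> bier_facet n c a'" by auto
    then have "a' = a \<or> a' = a(i := j)"
      using bier_facet_minus_vertex_subset[OF amon a(2,3)] M by auto
    then show "F = bier_facet n c a" using a a' by auto
  qed (use a in auto)
  ultimately have "?R \<in> {R \<in> bier_ball n c M. card R + 1 = complex_rank (bier_ball n c M) \<and>
      (\<exists>!F. F \<in> facets (bier_ball n c M) \<and> R \<subseteq> F)}"
    by (simp only: simps mem_Collect_eq)
  then show "G \<in> Bier n c M"
    unfolding Bier_def boundary_complex_def complex_generated_by_def
    by - (rule CollectI, rule bexI, rule G)
qed

lemma simplicial_complex_bier_faces:
  assumes "proper_multicomplex n c M"
  shows "simplicial_complex (bier_faces n c M)"
  unfolding simplicial_complex_def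
proof (intro conjI ballI allI impI)
  have "\<Union>(bier_faces n c M) \<subseteq> bier_vertices n c" by (auto simp: bier_faces_def)
  then show "finite (\<Union>(bier_faces n c M))" using finite_bier_vertices finite_subset by blast
  \<comment> \<open>The two witnesses exist because \<open>M\<close> is nonempty and proper.\<close>
  show "{} \<in> bier_faces n c M"
    using assms by (auto simp: bier_faces_def proper_multicomplex_def multicomplex_def)
  fix F G assume "F \<in> bier_faces n c M" "G \<subseteq> F"
  then show "G \<in> bier_faces n c M" unfolding bier_faces_def by blast
qed

text \<open>Every face lies in a boundary ridge, itself a face, so a facet equals such a ridge; all
  of them have the same size.\<close>

lemma pure_complex_bier_faces:
  assumes "proper_multicomplex n c M"
  shows "pure_complex (bier_faces n c M)"
proof -
  have mc: "multicomplex n c M" using assms by (simp add: proper_multicomplex_def)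
  have "card F + 1 = card (bier_vertices n c) - n" if F: "F \<in> facets (bier_faces n c M)" for F
  proof -
    obtain a i j where a: "a \<in> M" "i \<in> {1..n}" "j \<le> c i" "a(i := j) \<notin> M"
      and sub: "F \<subseteq> bier_facet n c a - {(i, j)}"
      using bier_faces_subset_ridge[OF mc facetsD(1)[OF F]] by blast
    have "bier_facet n c a - {(i, j)} = F"
      using facetsD(2)[OF F _ sub] bier_ridge_mem_bier_faces[OF mc a] by simp
    moreover have "j \<noteq> a i" using a by (metis fun_upd_triv)
    ultimately show ?thesis using card_bier_ridge[of a n c i j] a mc multicomplex_monomials by blast
  qed
  then show ?thesis
    using simplicial_complex_bier_faces[OF assms] by (metis add_right_imp_eq pure_complex_def)
qed

section \<open>The contracted edge\<close>

lemma bier_faces_link_condition: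
  assumes pm: "proper_multicomplex n c M" and "p \<in> {1..n}" "q \<in> {1..n}" "p \<noteq> q"
  shows "link_condition (bier_faces n c M) (p, 0) (q, c q)"
proof -
  note sc = simplicial_complex_bier_faces[OF pm]
  have mc: "multicomplex n c M" using pm by (simp add: proper_multicomplex_def)
  have "insert (p, 0) (insert (q, c q) G) \<in> bier_faces n c M"
    if G: "insert (p, 0) G \<in> bier_faces n c M" "insert (q, c q) G \<in> bier_faces n c M" for G
  proof -
    obtain a b where ab: "insert (p, 0) G \<subseteq> bier_vertices n c" "a \<in> M" "b \<in> monomials n c" "b \<notin> M"
      "\<And>i. i \<in> {1..n} \<Longrightarrow> (i, a i) \<notin> insert (p, 0) G" "\<And>i. i \<in> {1..n} \<Longrightarrow> (i, b i) \<notin> insert (p, 0) G"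
      using G(1) by (rule bier_facesE) blast
    obtain a' b' where ab': "insert (q, c q) G \<subseteq> bier_vertices n c" "a' \<in> M" "b' \<in> monomials n c" "b' \<notin> M"
      "\<And>i. i \<in> {1..n} \<Longrightarrow> (i, a' i) \<notin> insert (q, c q) G" "\<And>i. i \<in> {1..n} \<Longrightarrow> (i, b' i) \<notin> insert (q, c q) G"
      using G(2) by (rule bier_facesE) blast
    \<comment> \<open>Here \<open>a\<close> and \<open>b\<close> avoid \<open>(p, 0)\<close>, while
      \<open>a'\<close> and \<open>b'\<close> avoid \<open>(q, c q)\<close>. If \<open>a\<close>
      hits \<open>(q, c q)\<close>, the smaller value \<open>a' q\<close> replaces it; if
      \<open>b'\<close> hits \<open>(p, 0)\<close>, the positive value \<open>b p\<close> does. The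
      new values still avoid \<open>G\<close>.\<close>
    define e where "e = (if a q = c q then a(q := a' q) else a)"
    define f where "f = (if b' p = 0 then b'(p := b p) else b')"
    have amon: "a \<in> monomials n c" "a' \<in> monomials n c"
      using ab ab' multicomplex_monomials[OF mc] by auto
    have "e \<le> a" using monomials_le[OF amon(2) assms(3)] by (auto simp: e_def le_fun_def)
    then have "e \<in> M" using ab mc by (blast intro: multicomplex_down)
    have "b' \<le> f" by (auto simp: f_def le_fun_def)
    then have "f \<notin> M" using ab' mc by (blast intro: multicomplex_down)
    have "f \<in> monomials n c"
      using ab' monomials_le[OF ab(3) assms(2)] assms(2) by (auto simp: f_def intro: monomials_update)
    show ?thesis
    proof (rule bier_facesI[OF _ \<open>e \<in> M\<close> \<open>f \<in> monomials n c\<close> \<open>f \<notin> M\<close>])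
      show "insert (p, 0) (insert (q, c q) G) \<subseteq> bier_vertices n c" using ab ab' by auto
      fix i assume i: "i \<in> {1..n}"
      show "(i, e i) \<notin> insert (p, 0) (insert (q, c q) G)"
        using ab(5)[OF i] ab'(5)[OF i] assms(4) by (auto simp: e_def)
      show "(i, f i) \<notin> insert (p, 0) (insert (q, c q) G)"
        using ab(6)[OF i] ab'(6)[OF i] assms(4) by (auto simp: f_def)
    qed
  qed
  then show ?thesis
    unfolding link_condition_def link_eq[OF sc]
    using assms(4) by (auto intro: simplicial_complex_down[OF sc])
qed

text \<open>A face of the link corresponds to transversals that avoid both ends of the edge. Losing
  the bottom of chain \<open>p\<close> renumbers that chain, which \<open>\<sigma>\<close> undoes;
  losing the top of chain \<open>q\<close> changes no numbering.\<close>

lemma link_bier_faces: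
  fixes n c M p q
  defines "c' \<equiv> c(p := c p - 1, q := c q - 1)"
  defines "M' \<equiv> {a \<in> monomials n c'. a(p := Suc (a p)) \<in> M}"
  defines "\<sigma> \<equiv> \<lambda>(i, t). (i, if i = p then Suc t else t)"
  assumes pm: "proper_multicomplex n c M" and pq: "p \<in> {1..n}" "q \<in> {1..n}" "p \<noteq> q"
    and edge: "{(p, 0), (q, c q)} \<in> bier_faces n c M"
  shows "0 < c p" "proper_multicomplex n c' M'"
    "link (bier_faces n c M) {(p, 0), (q, c q)} = (`) \<sigma> ` bier_faces n c' M'"
proof -
  let ?E = "{(p, 0), (q, c q)}"
  have mc: "multicomplex n c M" using pm by (simp add: proper_multicomplex_def)
  obtain a0 b0 where ab0: "a0 \<in> M" "b0 \<in> monomials n c" "b0 \<notin> M"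
    "\<And>i. i \<in> {1..n} \<Longrightarrow> (i, a0 i) \<notin> ?E" "\<And>i. i \<in> {1..n} \<Longrightarrow> (i, b0 i) \<notin> ?E"
    using edge by (rule bier_facesE) blast
  \<comment> \<open>Since \<open>b0\<close> is nonzero at \<open>p\<close> and below
    \<open>c q\<close> at \<open>q\<close>, the natural-number subtractions in \<open>c'\<close> are
    exact.\<close>
  have pos: "0 < c p" "0 < c q"
    using ab0(5)[OF pq(1)] ab0(5)[OF pq(2)] monomials_le[OF ab0(2) pq(1)] monomials_le[OF ab0(2) pq(2)]
    by auto
  then show "0 < c p" by simp
  define sh where "sh a = a(p := Suc (a p))" for a :: "nat \<Rightarrow> nat"
  \<comment> \<open>This inverts \<open>sh\<close> on monomials that avoid \<open>(p, 0)\<close>,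
    where \<open>a p\<close> is positive.\<close>
  define un where "un a = a(p := a p - 1)" for a :: "nat \<Rightarrow> nat"
  have M': "a \<in> M' \<longleftrightarrow> a \<in> monomials n c' \<and> sh a \<in> M" for a by (simp add: M'_def sh_def)
  have sh_mon: "sh a \<in> monomials n c" if "a \<in> monomials n c'" for a
    unfolding monomials_def
  proof (intro CollectI conjI ballI allI impI)
    fix i assume "i \<in> {1..n}"
    then show "sh a i \<le> c i"
      using monomials_le[OF that, of i] pos pq by (auto simp: sh_def c'_def split: if_splits)
  next
    fix i assume "i \<notin> {1..n}"
    then show "sh a i = 0" using that pq by (auto simp: sh_def monomials_def)
  qed
  have un_mon: "un a \<in> monomials n c'" "sh (un a) = a"
    if "a \<in> monomials n c" "(p, a p) \<notin> ?E" "(q, a q) \<notin> ?E" for a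
  proof -
    show "un a \<in> monomials n c'"
      unfolding monomials_def
    proof (intro CollectI conjI ballI allI impI)
      fix i assume "i \<in> {1..n}"
      then show "un a i \<le> c' i"
        using monomials_le[OF that(1), of i] that(2,3) pq by (auto simp: un_def c'_def)
    next
      fix i assume "i \<notin> {1..n}"
      then show "un a i = 0" using that pq by (auto simp: un_def monomials_def)
    qed
    show "sh (un a) = a" using that(2) by (auto simp: sh_def un_def)
  qed
  have "un a0 \<in> M'" "un b0 \<in> monomials n c'" "un b0 \<notin> M'"
    using un_mon[of a0] un_mon[of b0] ab0 pq multicomplex_monomials[OF mc] by (auto simp: M')
  moreover have "b \<in> M'" if "a \<in> M'" "b \<le> a" for a b
  proof -
    have "b \<in> monomials n c'" using that by (auto simp: M' intro: monomials_down)
    moreover have "sh b \<le> sh a" using that(2) by (auto simp: sh_def le_fun_def)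
    ultimately show ?thesis using that(1) mc by (auto simp: M' intro: multicomplex_down)
  qed
  ultimately show "proper_multicomplex n c' M'"
    unfolding proper_multicomplex_def multicomplex_def using M' by blast
  have sc: "simplicial_complex (bier_faces n c M)" using pm by (rule simplicial_complex_bier_faces)
  have inj: "inj \<sigma>" by (auto simp: inj_def \<sigma>_def split: if_splits)
  have sig: "\<sigma> (i, a i) = (i, sh a i)" for i a by (simp add: \<sigma>_def sh_def)
  have vert: "\<sigma> ` bier_vertices n c' = bier_vertices n c - ?E"
  proof (intro equalityI subsetI)
    fix x assume "x \<in> \<sigma> ` bier_vertices n c'"
    then show "x \<in> bier_vertices n c - ?E"
      using pos pq(3) by (auto simp: \<sigma>_def bier_vertices_def c'_def split: if_splits)
  next
    fix x assume x: "x \<in> bier_vertices n c - ?E"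
    obtain i t where it: "x = (i, t)" by fastforce
    have "x = \<sigma> (i, if i = p then t - 1 else t)" using x it by (auto simp: \<sigma>_def)
    moreover have "(i, if i = p then t - 1 else t) \<in> bier_vertices n c'"
      using x it pq(3) by (auto simp: bier_vertices_def c'_def)
    ultimately show "x \<in> \<sigma> ` bier_vertices n c'" by blast
  qed
  \<comment> \<open>Injectivity of \<open>\<sigma>\<close> keeps the point out of the image of
    \<open>G\<close>; being in the image of the vertices, which is disjoint from \<open>?E\<close>,
    it also avoids the edge.\<close>
  have avoid: "(i, sh a i) \<notin> \<sigma> ` G \<union> ?E"
    if "a \<in> monomials n c'" "i \<in> {1..n}" "(i, a i) \<notin> G" for a i G
  proof -
    have "(i, sh a i) \<notin> \<sigma> ` G" using that(3) by (simp add: sig[symmetric] inj_image_mem_iff[OF inj])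
    moreover have "(i, sh a i) \<in> \<sigma> ` bier_vertices n c'"
      using that(1,2) monomials_le[OF that(1,2)] by (auto simp: sig[symmetric] bier_vertices_def)
    ultimately show ?thesis unfolding vert by blast
  qed
  show "link (bier_faces n c M) ?E = (`) \<sigma> ` bier_faces n c' M'"
  proof (intro equalityI subsetI)
    fix G assume "G \<in> link (bier_faces n c M) ?E"
    then have G: "G \<inter> ?E = {}" "G \<union> ?E \<in> bier_faces n c M" by (simp_all add: link_eq[OF sc])
    obtain a b where ab: "G \<union> ?E \<subseteq> bier_vertices n c" "a \<in> M" "b \<in> monomials n c" "b \<notin> M"
      "\<And>i. i \<in> {1..n} \<Longrightarrow> (i, a i) \<notin> G \<union> ?E" "\<And>i. i \<in> {1..n} \<Longrightarrow> (i, b i) \<notin> G \<union> ?E"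
      using G(2) by (rule bier_facesE) blast
    have "G \<subseteq> \<sigma> ` bier_vertices n c'" unfolding vert using ab(1) G(1) by blast
    then obtain G' where G': "G' \<subseteq> bier_vertices n c'" "G = \<sigma> ` G'" by (auto simp: subset_image_iff)
    have a: "un a \<in> monomials n c'" "sh (un a) = a"
      using un_mon[of a] ab(2) ab(5)[OF pq(1)] ab(5)[OF pq(2)] multicomplex_monomials[OF mc] by auto
    have b: "un b \<in> monomials n c'" "sh (un b) = b"
      using un_mon[of b] ab(3) ab(6)[OF pq(1)] ab(6)[OF pq(2)] by auto
    have "G' \<in> bier_faces n c' M'"
    proof (rule bier_facesI[OF G'(1), of "un a" _ "un b"])
      show "un a \<in> M'" "un b \<in> monomials n c'" "un b \<notin> M'" using a b ab by (simp_all add: M')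
      fix i assume i: "i \<in> {1..n}"
      have "\<sigma> (i, un a i) \<notin> G" "\<sigma> (i, un b i) \<notin> G"
        using ab(5,6)[OF i] a(2) b(2) by (simp_all add: sig)
      then show "(i, un a i) \<notin> G'" "(i, un b i) \<notin> G'" using G'(2) by blast+
    qed
    then show "G \<in> (`) \<sigma> ` bier_faces n c' M'" using G'(2) by (rule rev_image_eqI)
  next
    fix G assume "G \<in> (`) \<sigma> ` bier_faces n c' M'"
    then obtain G' where G': "G' \<in> bier_faces n c' M'" "G = \<sigma> ` G'" by blast
    obtain a b where ab: "G' \<subseteq> bier_vertices n c'" "a \<in> M'" "b \<in> monomials n c'" "b \<notin> M'"
      "\<And>i. i \<in> {1..n} \<Longrightarrow> (i, a i) \<notin> G'" "\<And>i. i \<in> {1..n} \<Longrightarrow> (i, b i) \<notin> G'"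
      using G'(1) by (rule bier_facesE) blast
    have sub: "G \<subseteq> bier_vertices n c - ?E" unfolding G'(2) vert[symmetric] using ab(1) by blast
    have edge_sub: "?E \<subseteq> bier_vertices n c" using edge by (simp add: bier_faces_def)
    have "G \<union> ?E \<in> bier_faces n c M"
    proof (rule bier_facesI[of _ _ _ "sh a" _ "sh b"])
      show "G \<union> ?E \<subseteq> bier_vertices n c" using sub edge_sub by blast
      show "sh a \<in> M" "sh b \<in> monomials n c" "sh b \<notin> M" using ab sh_mon by (auto simp: M')
      fix i assume i: "i \<in> {1..n}"
      show "(i, sh a i) \<notin> G \<union> ?E" unfolding G'(2) using ab(2) ab(5)[OF i] i by (intro avoid) (auto simp: M')
      show "(i, sh b i) \<notin> G \<union> ?E" unfolding G'(2) using ab(3) ab(6)[OF i] i by (intro avoid)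
    qed
    then show "G \<in> link (bier_faces n c M) ?E" using sub by (auto simp: link_eq[OF sc])
  qed
qed

section \<open>Gluing two consecutive chains\<close>

text \<open>The map \<open>\<pi>\<close> glues the last two chains, identifying the top \<open>(k, c k)\<close> of the former with the
  bottom \<open>(Suc k, 0)\<close> of the latter; \<open>\<phi>\<close> embeds the glued chain into the product of the two as the
  path that first increases the \<open>k\<close>-th and then the \<open>Suc k\<close>-th exponent.\<close>

lemma merge_bier_faces:
  fixes k c M
  defines "c' \<equiv> c(k := c k + c (Suc k))"
  defines "\<phi> \<equiv> \<lambda>a. a(k := min (a k) (c k), Suc k := a k - c k)"
  defines "M' \<equiv> {a \<in> monomials k c'. \<phi> a \<in> M}"
  defines "\<pi> \<equiv> \<lambda>(i, t). if i = Suc k then (k, c k + t) else (i, t)"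
  assumes pm: "proper_multicomplex (Suc k) c M" and k: "0 < k"
  shows "proper_multicomplex k c' M'"
    "(`) \<pi> ` bier_faces (Suc k) c M = bier_faces k c' M'"
proof -
  have mc: "multicomplex (Suc k) c M" using pm by (simp add: proper_multicomplex_def)
  \<comment> \<open>On the path described by \<open>\<phi>\<close>, \<open>low a\<close> gives a
    point below \<open>a\<close> and \<open>up b\<close> a point above \<open>b\<close>. In each
    case the glued coordinate is the image under \<open>\<pi>\<close> of one of the two original
    points, so avoidance is preserved.\<close>
  define low where
    "low a = a(k := if a k < c k then a k else c k + a (Suc k), Suc k := 0)" for a :: "nat \<Rightarrow> nat"
  define up where
    "up b = b(k := if 0 < b (Suc k) then c k + b (Suc k) else b k, Suc k := 0)" for b :: "nat \<Rightarrow> nat"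
  have M': "a \<in> M' \<longleftrightarrow> a \<in> monomials k c' \<and> \<phi> a \<in> M" for a by (simp add: M'_def)
  have phi_mon: "\<phi> a \<in> monomials (Suc k) c" if "a \<in> monomials k c'" for a
    unfolding monomials_def
  proof (intro CollectI conjI ballI allI impI)
    fix i
    show "\<phi> a i \<le> c i" if "i \<in> {1..Suc k}"
      using that k monomials_le[OF \<open>a \<in> monomials k c'\<close>, of i] monomials_le[OF \<open>a \<in> monomials k c'\<close>, of k]
      by (cases "i = Suc k") (auto simp: \<phi>_def c'_def split: if_splits)
    show "\<phi> a i = 0" if "i \<notin> {1..Suc k}"
      using that k \<open>a \<in> monomials k c'\<close> by (auto simp: \<phi>_def monomials_def)
  qed
  have phi_mono: "\<phi> a \<le> \<phi> b" if "a \<le> b" for a b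
  proof (rule le_funI)
    fix i show "\<phi> a i \<le> \<phi> b i"
      using le_funD[OF that, of i] le_funD[OF that, of k]
      by (auto simp: \<phi>_def min_le_iff_disj diff_le_mono)
  qed
  have low: "low a \<in> monomials k c'" "\<phi> (low a) \<le> a"
    and up: "up a \<in> monomials k c'" "a \<le> \<phi> (up a)" if "a \<in> monomials (Suc k) c" for a
  proof -
    have le: "a i \<le> c i" if "i \<in> {1..Suc k}" for i
      using monomials_le[OF \<open>a \<in> monomials (Suc k) c\<close> that] .
    have z: "a i = 0" if "i \<notin> {1..Suc k}" for i
      using \<open>a \<in> monomials (Suc k) c\<close> that by (simp add: monomials_def)
    have lek: "a k \<le> c k" "a (Suc k) \<le> c (Suc k)" using le k by auto
    have z': "a i = 0" if "i \<notin> {1..k}" "i \<noteq> Suc k" for i using z[of i] that by auto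
    show "low a \<in> monomials k c'" "up a \<in> monomials k c'"
      using lek le z' k trans_le_add1[OF lek(1)] by (auto simp: monomials_def low_def up_def c'_def)
    show "\<phi> (low a) \<le> a" "a \<le> \<phi> (up a)"
      using lek by (auto simp: \<phi>_def low_def up_def le_fun_def)
  qed
  obtain a0 b0 where ab0: "a0 \<in> M" "b0 \<in> monomials (Suc k) c" "b0 \<notin> M"
    using pm by (auto simp: proper_multicomplex_def multicomplex_def)
  have lowM: "low a \<in> M'" if "a \<in> M" for a
    using that low[OF multicomplex_monomials[OF mc that]] mc by (auto simp: M' intro: multicomplex_down)
  have upM: "up b \<notin> M'" if "b \<in> monomials (Suc k) c" "b \<notin> M" for b
    using that up[OF that(1)] mc by (auto simp: M' dest: multicomplex_down)
  have downM: "b \<in> M'" if "a \<in> M'" "b \<le> a" for a b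
    using that phi_mono[OF that(2)] mc by (auto simp: M' intro: multicomplex_down monomials_down)
  show "proper_multicomplex k c' M'"
    unfolding proper_multicomplex_def multicomplex_def
    using lowM[OF ab0(1)] upM[OF ab0(2,3)] up(1)[OF ab0(2)] downM M' by blast
  show "(`) \<pi> ` bier_faces (Suc k) c M = bier_faces k c' M'"
  proof (intro equalityI subsetI)
    fix G' assume "G' \<in> (`) \<pi> ` bier_faces (Suc k) c M"
    then obtain G where G: "G \<in> bier_faces (Suc k) c M" "G' = \<pi> ` G" by blast
    obtain a b where ab: "G \<subseteq> bier_vertices (Suc k) c" "a \<in> M" "b \<in> monomials (Suc k) c" "b \<notin> M"
      "\<And>i. i \<in> {1..Suc k} \<Longrightarrow> (i, a i) \<notin> G" "\<And>i. i \<in> {1..Suc k} \<Longrightarrow> (i, b i) \<notin> G"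
      using G(1) by (rule bier_facesE) blast
    have le: "t \<le> c i" "i \<in> {1..Suc k}" if "(i, t) \<in> G" for i t
      using subsetD[OF ab(1) that] by (simp_all add: bier_vertices_def)
    have amon: "a \<in> monomials (Suc k) c" using mc ab(2) by (rule multicomplex_monomials)
    \<comment> \<open>For \<open>i = k\<close>, all vertices that \<open>\<pi>\<close> sends to
      either glued point are among \<open>(k, e k)\<close> and \<open>(Suc k, e (Suc k))\<close>.
      This includes the doubly covered \<open>(k, c k)\<close>: the definitions of
      \<open>low\<close> and \<open>up\<close> yield it only if \<open>e k = c k\<close> and
      \<open>e (Suc k) = 0\<close>, so both preimages are avoided.\<close>
    have avoid: "(i, low e i) \<notin> \<pi> ` G" "(i, up e i) \<notin> \<pi> ` G"
      if i: "i \<in> {1..k}" and e: "e \<in> monomials (Suc k) c" "\<And>i. i \<in> {1..Suc k} \<Longrightarrow> (i, e i) \<notin> G" for e i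
    proof -
      have ek: "e k \<le> c k" "(k, e k) \<notin> G" "(Suc k, e (Suc k)) \<notin> G" "(i, e i) \<notin> G"
        using e(2) monomials_le[OF e(1), of k] i by auto
      have "(i, low e i) \<noteq> \<pi> (i', t) \<and> (i, up e i) \<noteq> \<pi> (i', t)" if g: "(i', t) \<in> G" for i' t
      proof -
        have "i' = Suc k \<Longrightarrow> t \<noteq> e (Suc k)" "i' = k \<Longrightarrow> t \<noteq> e k" "i' = i \<Longrightarrow> t \<noteq> e i"
          using g ek by auto
        then show ?thesis
          using i ek(1) le(1)[OF g] by (auto simp: \<pi>_def low_def up_def)
      qed
      then show "(i, low e i) \<notin> \<pi> ` G" "(i, up e i) \<notin> \<pi> ` G" by fast+
    qed
    show "G' \<in> bier_faces k c' M'"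
    proof (rule bier_facesI[of _ _ _ "low a" _ "up b"])
      have "\<pi> (i, t) \<in> bier_vertices k c'" if "(i, t) \<in> G" for i t
        using le[OF that] k by (auto simp: \<pi>_def bier_vertices_def c'_def)
      then show "G' \<subseteq> bier_vertices k c'" unfolding G(2) by auto
      show "low a \<in> M'" "up b \<in> monomials k c'" "up b \<notin> M'" using ab lowM up upM by auto
      fix i assume i: "i \<in> {1..k}"
      show "(i, low a i) \<notin> G'" unfolding G(2) using i amon ab(5) by (rule avoid)
      show "(i, up b i) \<notin> G'" unfolding G(2) using i ab(3) ab(6) by (rule avoid)
    qed
  next
    fix G' assume "G' \<in> bier_faces k c' M'"
    then obtain a b where ab: "G' \<subseteq> bier_vertices k c'" "a \<in> M'" "b \<in> monomials k c'" "b \<notin> M'"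
      "\<And>i. i \<in> {1..k} \<Longrightarrow> (i, a i) \<notin> G'" "\<And>i. i \<in> {1..k} \<Longrightarrow> (i, b i) \<notin> G'"
      by (rule bier_facesE) blast
    have amon: "a \<in> monomials k c'" using ab(2) by (simp add: M')
    \<comment> \<open>The full preimage of \<open>G'\<close> may be too large to be a face. Only
      \<open>?p\<close> and \<open>?q\<close> are identified by \<open>\<pi>\<close>, so dropping
      either one still leaves a set mapping onto \<open>G'\<close>.\<close>
    define P where "P = {x \<in> bier_vertices (Suc k) c. \<pi> x \<in> G'}"
    let ?p = "(Suc k, 0)" and ?q = "(k, c k)"
    have img: "\<pi> ` (P - {?p}) = G'" "\<pi> ` (P - {?q}) = G'"
    proof -
      have "(i, t) \<in> \<pi> ` (P - {?p}) \<and> (i, t) \<in> \<pi> ` (P - {?q})" if g: "(i, t) \<in> G'" for i t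
      proof -
        have it: "i \<in> {1..k}" "t \<le> c' i" using subsetD[OF ab(1) g] by (simp_all add: bier_vertices_def)
        \<comment> \<open>Both are preimages of \<open>(i, t)\<close>; at the glue point
          \<open>x\<close> chooses \<open>?q\<close> and \<open>y\<close> chooses
          \<open>?p\<close>.\<close>
        define x where "x = (if i = k \<and> c k < t then (Suc k, t - c k) else (i, t))"
        define y where "y = (if i = k \<and> c k \<le> t then (Suc k, t - c k) else (i, t))"
        have "\<pi> x = (i, t)" "\<pi> y = (i, t)" using it by (auto simp: \<pi>_def x_def y_def)
        moreover have "x \<in> bier_vertices (Suc k) c" "y \<in> bier_vertices (Suc k) c"
          using it by (auto simp: bier_vertices_def x_def y_def c'_def split: if_splits)
        moreover have "x \<noteq> ?p" "y \<noteq> ?q" using it by (auto simp: x_def y_def)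
        ultimately show ?thesis
          using g unfolding P_def by (metis (mono_tags, lifting) Diff_iff image_eqI mem_Collect_eq singletonD)
      qed
      then show "\<pi> ` (P - {?p}) = G'" "\<pi> ` (P - {?q}) = G'" by (auto simp: P_def)
    qed
    \<comment> \<open>On the lower half of the glued chain, \<open>\<phi> e\<close> passes through
      the bottom \<open>?p\<close> of the last chain; on the upper half, treated next, through
      \<open>?q\<close>. In each case that point is the removed one.\<close>
    have avoid_p: "(i, \<phi> e i) \<notin> P - {?p}"
      if "e k \<le> c k" "\<And>i. i \<in> {1..k} \<Longrightarrow> (i, e i) \<notin> G'" "i \<in> {1..Suc k}" for e i
      using that(1) that(2)[of i] that(3) k by (auto simp: P_def \<pi>_def \<phi>_def split: if_splits)
    have avoid_q: "(i, \<phi> e i) \<notin> P - {?q}"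
      if "c k \<le> e k" "\<And>i. i \<in> {1..k} \<Longrightarrow> (i, e i) \<notin> G'" "i \<in> {1..Suc k}" for e i
      using that(1) that(2)[of i] that(2)[of k] that(3) k
      by (auto simp: P_def \<pi>_def \<phi>_def split: if_splits)
    have phib: "\<phi> b \<in> monomials (Suc k) c" "\<phi> b \<notin> M" using ab phi_mon by (auto simp: M')
    have sub: "P - X \<subseteq> bier_vertices (Suc k) c" for X by (auto simp: P_def)
    have "P - {?p} \<in> bier_faces (Suc k) c M \<or> P - {?q} \<in> bier_faces (Suc k) c M"
    proof (cases "b k \<le> c k")
      case True
      \<comment> \<open>If \<open>a\<close> is on the upper half, lowering it to \<open>b k\<close>
        keeps it in \<open>M\<close> and moves it to the half of \<open>b\<close>; the transversal
        still avoids \<open>G'\<close>.\<close>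
      define a' where "a' = (if a k \<le> c k then a else a(k := b k))"
      have "a' \<le> a" using True by (auto simp: a'_def le_fun_def)
      then have a': "\<phi> a' \<in> M" using downM ab(2) M' by blast
      have "a' k \<le> c k" "\<And>i. i \<in> {1..k} \<Longrightarrow> (i, a' i) \<notin> G'"
        using True ab(5,6) by (auto simp: a'_def)
      then have "P - {?p} \<in> bier_faces (Suc k) c M"
        using True ab(6) by (intro bier_facesI[OF sub a' phib] avoid_p)
      then show ?thesis ..
    next
      case b: False
      show ?thesis
      proof (cases "c k \<le> a k")
        case True
        have "P - {?q} \<in> bier_faces (Suc k) c M"
          using True b ab(2,5,6) by (intro bier_facesI[OF sub _ phib, of "\<phi> a"] avoid_q) (auto simp: M')
        then show ?thesis ..
      next
        case False
        \<comment> \<open>With \<open>a\<close> strictly below and \<open>b\<close> strictly above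
          the glue point, \<open>e\<close> takes the coordinate \<open>k\<close> from
          \<open>a\<close> and all others from \<open>\<phi> b\<close>. It passes through neither
          \<open>?p\<close> nor \<open>?q\<close> and avoids all of \<open>P\<close>, so it can
          replace whichever witness is on the wrong side, depending on whether it lies in
          \<open>M\<close>.\<close>
        define e where "e = b(k := a k, Suc k := b k - c k)"
        have emon: "e \<in> monomials (Suc k) c"
          using monomials_update[OF phib(1), of k "a k"] False b k
          by (simp add: e_def \<phi>_def fun_upd_twist)
        have e: "(i, e i) \<notin> P" if "i \<in> {1..Suc k}" for i
          using that b k ab(5)[of k] ab(6)[of k] ab(6)[of i] by (auto simp: P_def \<pi>_def e_def)
        show ?thesis
        proof (cases "e \<in> M")
          case True
          have "P - {?q} \<in> bier_faces (Suc k) c M"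
            using b ab(6) e by (intro bier_facesI[OF sub True phib] avoid_q) auto
          then show ?thesis ..
        next
          case eM: False
          have "P - {?p} \<in> bier_faces (Suc k) c M"
            using False ab(2,5) e
            by (intro bier_facesI[OF sub _ emon eM, of "\<phi> a"] avoid_p) (auto simp: M')
          then show ?thesis ..
        qed
      qed
    qed
    then show "G' \<in> (`) \<pi> ` bier_faces (Suc k) c M"
      using img by (metis imageI)
  qed
qed

section \<open>The single chain and the double induction\<close>

lemma bier_faces_one_chain:
  assumes "proper_multicomplex 1 c M"
  shows "edge_decomposable (bier_faces 1 c M)"
proof -
  \<comment> \<open>A monomial in one variable is a vertex of the single chain, so \<open>A\<close>
    and \<open>B\<close> partition the chain, and avoiding a transversal on each side means
    containing neither \<open>A\<close> nor \<open>B\<close>.\<close>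
  define A where "A = {(1 :: nat, a 1) | a. a \<in> M}"
  define B where "B = {(1 :: nat, b 1) | b. b \<in> monomials 1 c - M}"
  have M: "M \<noteq> {}" "M \<subseteq> monomials 1 c" "monomials 1 c - M \<noteq> {}"
    using assms by (auto simp: proper_multicomplex_def multicomplex_def)
  have AB: "A \<union> B = bier_vertices 1 c"
  proof (intro equalityI subsetI)
    fix x assume "x \<in> A \<union> B"
    then show "x \<in> bier_vertices 1 c"
      using M(2) by (auto simp: A_def B_def bier_vertices_def monomials_def)
  next
    fix x assume "x \<in> bier_vertices 1 c"
    then obtain j where j: "x = (1, j)" "j \<le> c 1" by (auto simp: bier_vertices_def)
    then have "(\<lambda>i. 0)(1 := j) \<in> monomials 1 c" by (auto simp: monomials_def)
    moreover have "x = (1, ((\<lambda>i. 0)(1 := j)) 1)" using j(1) by simp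
    ultimately show "x \<in> A \<union> B" unfolding A_def B_def by blast
  qed
  have disj: "A \<inter> B = {}"
  proof -
    have "a = b" if "a \<in> M" "b \<in> monomials 1 c" "a 1 = b 1" for a b
      using that M(2) by (intro monomials_eqI[of _ 1 c]) auto
    then show ?thesis by (auto simp: A_def B_def)
  qed
  have "bier_faces 1 c M = boundary_join A B"
    unfolding bier_faces_def boundary_join_def AB by (auto simp: A_def B_def)
  moreover have "finite A" "finite B" using AB finite_bier_vertices[of 1 c] by (metis finite_Un)+
  moreover have "A \<noteq> {}" "B \<noteq> {}" using M by (auto simp: A_def B_def)
  ultimately show ?thesis using disj by (simp add: edge_decomposable_boundary_join)
qed

text \<open>The outer induction on the number of chains handles the contraction. The link keeps all
  chains but shortens the last one, so it is handled by an inner induction on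
  \<open>c (Suc k)\<close>.\<close>

lemma edge_decomposable_bier_faces:
  assumes "proper_multicomplex n c M"
  shows "edge_decomposable (bier_faces n c M)"
  using assms
proof (induction n arbitrary: c M)
  case 0
  \<comment> \<open>With a single monomial, a nonempty \<open>M\<close> cannot be proper.\<close>
  have "monomials 0 c = {\<lambda>i. 0}" by (auto simp: monomials_def)
  then show ?case using 0 by (auto simp: proper_multicomplex_def multicomplex_def)
next
  case (Suc k)
  show ?case
  proof (cases "k = 0")
    case True
    then show ?thesis using Suc.prems bier_faces_one_chain by simp
  next
    case False
    then have k: "0 < k" by simp
    show ?thesis
      using Suc.prems
    proof (induction "c (Suc k)" arbitrary: c M rule: less_induct)
      case less
      let ?\<Delta> = "bier_faces (Suc k) c M" and ?p = "(Suc k, 0)" and ?q = "(k, c k)"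
      let ?\<pi> = "\<lambda>(i, t). if i = Suc k then (k, c k + t) else (i, t)"
      note sc = simplicial_complex_bier_faces[OF less.prems]
      have merged: "edge_decomposable ((`) ?\<pi> ` ?\<Delta>)"
        unfolding merge_bier_faces(2)[OF less.prems k]
        by (rule Suc.IH[OF merge_bier_faces(1)[OF less.prems k]])
      have vert: "\<Union>?\<Delta> \<subseteq> bier_vertices (Suc k) c" by (auto simp: bier_faces_def)
      \<comment> \<open>The only two vertices glued together are \<open>?p\<close> and
        \<open>?q\<close>.\<close>
      have inj: "inj_on ?\<pi> S" if "S \<subseteq> bier_vertices (Suc k) c" "\<not> (?p \<in> S \<and> ?q \<in> S)" for S
      proof (rule inj_onI)
        fix x y assume xy: "x \<in> S" "y \<in> S" "?\<pi> x = ?\<pi> y"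
        obtain i t i' t' where it: "x = (i, t)" "y = (i', t')" by fastforce
        have "t \<le> c i" "t' \<le> c i'" using xy that(1) it by (auto simp: bier_vertices_def)
        then show "x = y" using xy that(2) it by (auto split: if_splits)
      qed
      have lc: "link_condition ?\<Delta> ?p ?q"
        using less.prems k by (intro bier_faces_link_condition) auto
      show ?case
      proof (cases "?p \<in> \<Union>?\<Delta> \<and> ?q \<in> \<Union>?\<Delta>")
        case False
        then have "inj_on ?\<pi> (\<Union>?\<Delta>)" using vert by (intro inj)
        then show ?thesis using merged by (simp add: edge_decomposable_image_iff)
      next
        case True
        then have "{?p} \<in> ?\<Delta>" "{?q} \<in> ?\<Delta>" by (auto intro: simplicial_complex_down[OF sc])
        \<comment> \<open>Applied to the empty face, the link condition shows that two vertices of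
          the sphere already span an edge.\<close>
        then have "{} \<in> link ?\<Delta> {?p} \<inter> link ?\<Delta> {?q}" by (simp add: link_eq[OF sc])
        then have "{} \<in> link ?\<Delta> {?p, ?q}" using lc by (simp only: link_condition_def)
        then have edge: "{?p, ?q} \<in> ?\<Delta>" by (simp add: link_eq[OF sc])
        have "Suc k \<in> {1..Suc k}" "k \<in> {1..Suc k}" "Suc k \<noteq> k" using k by auto
        note lk = link_bier_faces[OF less.prems this edge]
        have ed_link: "edge_decomposable (link ?\<Delta> {?p, ?q})"
          unfolding lk(3)
        proof (rule edge_decomposable_image[OF less.hyps[OF _ lk(2)]])
          show "(c(Suc k := c (Suc k) - 1, k := c k - 1)) (Suc k) < c (Suc k)" using lk(1) by simp
        qed (auto simp: inj_on_def split: if_splits)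
        have Un_contr: "\<Union>(contraction ?\<Delta> ?p ?q) \<subseteq> \<Union>?\<Delta> - {?p}"
          using Union_contraction_subset[of ?p ?q ?\<Delta>] True by auto
        \<comment> \<open>Contracting first changes nothing after gluing, and \<open>?\<pi>\<close>
          is injective on the contraction because \<open>?p\<close> is gone; so the contraction is
          isomorphic to the glued sphere.\<close>
        have "?\<pi> ` (id(?p := ?q)) ` F = ?\<pi> ` F" for F
          unfolding image_image by (rule image_cong) auto
        then have "(`) ?\<pi> ` contraction ?\<Delta> ?p ?q = (`) ?\<pi> ` ?\<Delta>"
          unfolding contraction_eq_image image_image[of "(`) _"] by simp
        then have "edge_decomposable ((`) ?\<pi> ` contraction ?\<Delta> ?p ?q)" using merged by (simp only:)
        moreover have "inj_on ?\<pi> (\<Union>(contraction ?\<Delta> ?p ?q))"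
          using Un_contr vert by (intro inj) blast+
        ultimately have ed_contr: "edge_decomposable (contraction ?\<Delta> ?p ?q)"
          by (simp only: edge_decomposable_image_iff)
        show ?thesis
          using pure_complex_bier_faces[OF less.prems] _ edge lc ed_link ed_contr
          by (rule edge_decomposable.contract_edge) simp
      qed
    qed
  qed
qed

theorem theorem4p6:
  fixes n :: nat and c :: "nat \<Rightarrow> nat" and M :: "(nat \<Rightarrow> nat) set"
  assumes "proper_multicomplex n c M"
  shows "edge_decomposable (Bier n c M)"
  using assms edge_decomposable_bier_faces[OF assms]
  by (simp add: Bier_eq_bier_faces proper_multicomplex_def)

end
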